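(* The set of all complex Wiener roots of trees is not contained in any half-plane; consequently the set of all complex Wiener roots of connected graphs is not contained in any half-plane either.
   Context: For a connected graph $G$ of order at least $2$, the Wiener polynomial is $W(G;x)=\sum x^{d(u,v)}$, where $d(u,v)$ is the distance between $u$ and $v$ and the sum ranges over all unordered pairs of distinct vertices. A Wiener root of $G$ is a complex root of $W(G;x)$. A half-plane is a region of the complex plane consisting of all points lying on one side of some line (and no points on the other side). *)

theory Defs
  imports
    Graph_Theory.Graph_Theory
    "HOL-Analysis.Inner_Product"
    "HOL-Computational_Algebra.Polynomial"
begin

text \<open>
  A finite simple graph is a \<^locale>\<open>pair_graph\<close>: a finite, loop-free, symmetric arc relation, the
  edge \<open>uv\<close> being represented by the two arcs \<open>(u, v)\<close> and \<open>(v, u)\<close>.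
\<close>

definition connected_graph :: "'a pair_pre_digraph \<Rightarrow> bool" where
  "connected_graph G \<longleftrightarrow> pair_graph G \<and> Digraph_Component.connected (with_proj G)"

text \<open>
  In a symmetric digraph the walk \<open>u, v, u\<close> along a single edge counts as a
  \<^const>\<open>pre_digraph.cycle\<close>, so \<^const>\<open>Digraph_Component.tree\<close> is not the notion of a tree for
  undirected graphs. The cycles of the undirected graph are those of length at least 3.
\<close>

definition tree_graph :: "'a pair_pre_digraph \<Rightarrow> bool" where
  "tree_graph G \<longleftrightarrow>
     connected_graph G \<and> \<not> (\<exists>p. pre_digraph.cycle (with_proj G) p \<and> length p \<ge> 3)"

definition graph_dist :: "'a pair_pre_digraph \<Rightarrow> 'a \<Rightarrow> 'a \<Rightarrow> nat" where
  "graph_dist G u v = (LEAST n. \<exists>p. pre_digraph.awalk (with_proj G) u p v \<and> length p = n)"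

text \<open>The linear order serves only to list every unordered pair of distinct vertices once.\<close>

definition wiener_poly :: "'a::linorder pair_pre_digraph \<Rightarrow> complex poly" where
  "wiener_poly G = (\<Sum>(u, v) \<in> {(u, v). u \<in> pverts G \<and> v \<in> pverts G \<and> u < v}.
     monom 1 (graph_dist G u v))"

definition wiener_roots :: "'a::linorder pair_pre_digraph \<Rightarrow> complex set" where
  "wiener_roots G = {z. poly (wiener_poly G) z = 0}"

text \<open>
  The line is \<open>{z. a \<bullet> z = b}\<close>. A half-plane contains all points strictly on one side of it and
  none strictly on the other; points of the line itself may or may not belong to it, so open and
  closed half-planes are both covered.
\<close>

definition half_plane :: "complex set \<Rightarrow> bool" where
  "half_plane H \<longleftrightarrow> (\<exists>a b. a \<noteq> 0 \<and> {z. inner a z > b} \<subseteq> H \<and> H \<subseteq> {z. inner a z \<ge> b})"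

text \<open>
  Every finite graph is isomorphic to one whose vertices are natural numbers, so these sets collect
  the Wiener roots of all trees and of all connected graphs of order at least 2.
\<close>

definition tree_wiener_roots :: "complex set" where
  "tree_wiener_roots =
     (\<Union>G \<in> {G :: nat pair_pre_digraph. tree_graph G \<and> card (pverts G) \<ge> 2}. wiener_roots G)"

definition connected_wiener_roots :: "complex set" where
  "connected_wiener_roots =
     (\<Union>G \<in> {G :: nat pair_pre_digraph. connected_graph G \<and> card (pverts G) \<ge> 2}. wiener_roots G)"

end

theory Submission
  imports Defs "HOL-Computational_Algebra.Fundamental_Theorem_Algebra"
begin

text \<open>
  Attach \<open>N = R\<^sup>3\<close> leaves to vertex \<open>4\<close> of the path \<open>0, \<dots>, 9\<close>. A leaf has eccentricity \<open>6\<close>, so the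
  Wiener polynomial is \<open>x\<^sup>9 + N x\<^sup>6\<close> plus terms that are \<open>O(R\<^sup>8)\<close> for \<open>|x| = R\<close>; this includes the
  pairs of leaves, which contribute about \<open>N\<^sup>2 x\<^sup>2 / 2\<close>. If \<open>\<zeta>\<^sup>3 = -1\<close>, the two leading terms cancel
  at \<open>R \<zeta>\<close>, and since the polynomial is monic of degree \<open>9\<close>, its value there is the product of the
  distances to the roots: some root lies within \<open>O(R\<^bsup>8/9\<^esup>) = o(R)\<close> of \<open>R \<zeta>\<close>. The three cube roots of
  \<open>-1\<close> are not contained in any closed half-plane bounded by a line through the origin, so the roots
  leave every half-plane as \<open>R\<close> grows.
\<close>

section \<open>Trees given by parent functions\<close>

text \<open>If \<open>f v < v\<close> for every nonzero vertex, this is a tree rooted at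
  \<open>0\<close>, and connectedness and acyclicity become statements about the order of the
  labels. The guards \<open>0 < u\<close> and \<open>0 < v\<close> keep the root from having a
  parent.\<close>

definition parent_graph :: "(nat \<Rightarrow> nat) \<Rightarrow> nat \<Rightarrow> nat pair_pre_digraph" where
  "parent_graph f n = \<lparr>pverts = {..n},
     parcs = {(u, v). u \<le> n \<and> v \<le> n \<and> (0 < u \<and> v = f u \<or> 0 < v \<and> u = f v)}\<rparr>"

lemma pverts_parent_graph [simp]: "pverts (parent_graph f n) = {..n}"
  by (simp add: parent_graph_def)

lemma parcs_parent_graph [simp]:
  "(u, v) \<in> parcs (parent_graph f n) \<longleftrightarrow>
     u \<le> n \<and> v \<le> n \<and> (0 < u \<and> v = f u \<or> 0 < v \<and> u = f v)"
  by (simp add: parent_graph_def)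

lemma pair_graph_parent_graph:
  assumes "\<And>v. 0 < v \<Longrightarrow> v \<le> n \<Longrightarrow> f v < v"
  shows "pair_graph (parent_graph f n)"
proof
  have "parcs (parent_graph f n) \<subseteq> {..n} \<times> {..n}"
    by (auto simp: parent_graph_def)
  then show "finite (parcs (parent_graph f n))"
    by (rule finite_subset) simp
  show "symmetric (with_proj (parent_graph f n))"
    by (auto simp: symmetric_def parent_graph_def arcs_ends_def intro!: symI)
  show "finite (pverts (parent_graph f n))"
    by simp
next
  fix e assume e: "e \<in> parcs (parent_graph f n)"
  obtain u v where [simp]: "e = (u, v)" by (cases e)
  show "fst e \<in> pverts (parent_graph f n)" "snd e \<in> pverts (parent_graph f n)"
    using e by auto
  show "fst e \<noteq> snd e"
    using e assms[of u] assms[of v] by auto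
qed

text \<open>Iterating \<open>f\<close> descends from any vertex to the root \<open>0\<close>; by
  symmetry of the arcs, one descent followed by the reverse of another joins any two
  vertices.\<close>

lemma connected_graph_parent_graph:
  assumes "\<And>v. 0 < v \<Longrightarrow> v \<le> n \<Longrightarrow> f v < v"
  shows "connected_graph (parent_graph f n)"
proof -
  let ?G = "parent_graph f n"
  interpret pair_graph ?G by (rule pair_graph_parent_graph[OF assms])
  have root: "v \<rightarrow>\<^sup>*\<^bsub>with_proj ?G\<^esub> 0" if "v \<le> n" for v
    using that
  proof (induction v rule: less_induct)
    case (less v)
    show ?case
    proof (cases "v = 0")
      case False
      then have "f v < v" using assms less.prems by simp
      then have "(v, f v) \<in> parcs ?G" using False less.prems by simp
      moreover have "f v \<rightarrow>\<^sup>*\<^bsub>with_proj ?G\<^esub> 0"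
        using less \<open>f v < v\<close> by simp
      ultimately show ?thesis by (rule adj_reachable_trans)
    qed simp
  qed
  have "u \<rightarrow>\<^sup>*\<^bsub>with_proj ?G\<^esub> v" if "u \<le> n" "v \<le> n" for u v
    using root[OF that(1)] root[OF that(2)] symmetric_reachable' reachable_trans by metis
  then have "Digraph_Component.connected (with_proj ?G)"
    by (intro connectedI) (auto simp: reachable_mk_symmetric_eq[OF pair_sym_arcs])
  then show ?thesis
    unfolding connected_graph_def using pair_graph_parent_graph[OF assms] by blast
qed

lemma (in wf_digraph) awalk_verts_adj:
  assumes "awalk u p v" "i < length p"
  shows "awalk_verts u p ! i \<rightarrow> awalk_verts u p ! Suc i"
  using assms
proof (induction p arbitrary: u i)
  case (Cons e p)
  then have e: "e \<in> arcs G" "u = tail G e" "awalk (head G e) p v"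
    by (auto simp: awalk_Cons_iff)
  have "awalk_verts (head G e) p ! 0 = head G e"
    using e(3) by (cases p) (auto simp: awalk_Cons_iff)
  then show ?case
    using e Cons by (cases i) (auto simp: dominatesI arc_to_ends_def intro!: in_arcs_imp_in_arcs_ends)
qed simp

text \<open>The largest vertex of a cycle is the child of both its neighbours on the cycle, so they coincide.\<close>

lemma tree_graph_parent_graph:
  assumes less: "\<And>v. 0 < v \<Longrightarrow> v \<le> n \<Longrightarrow> f v < v"
  shows "tree_graph (parent_graph f n)"
  unfolding tree_graph_def
proof (intro conjI notI)
  show "connected_graph (parent_graph f n)"
    using less by (rule connected_graph_parent_graph)
next
  let ?G = "parent_graph f n"
  interpret pair_graph ?G by (rule pair_graph_parent_graph[OF less])
  assume "\<exists>p. cycle p \<and> 3 \<le> length p"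
  then obtain p u where p: "awalk u p u" "distinct (tl (pawalk_verts u p))" "3 \<le> length p"
    by (auto simp: cycle_def)
  define w where "w i = pawalk_verts u p ! i" for i
  define k where "k = length p"
  have len: "length (pawalk_verts u p) = Suc k"
    using length_awalk_verts[of u p] by (simp add: k_def)
  have adj: "(w i, w (Suc i)) \<in> parcs ?G" if "i < k" for i
    using awalk_verts_adj[OF p(1)] that by (simp add: w_def k_def)
  \<comment> \<open>The other possibility, \<open>y = f x\<close>, would give
    \<open>y < x\<close>.\<close>
  have parent: "x = f y" if "(x, y) \<in> parcs ?G \<or> (y, x) \<in> parcs ?G" "x \<le> y" for x y
    using that less[of x] by auto
  \<comment> \<open>The \<open>k + 1\<close> entries of the vertex list begin and end with the same
    vertex, so injectivity is claimed only for the indices from \<open>1\<close> to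
    \<open>k\<close>.\<close>
  have inj: "i = j" if "w i = w j" "0 < i" "i \<le> k" "0 < j" "j \<le> k" for i j
  proof -
    have "tl (pawalk_verts u p) ! (i - 1) = tl (pawalk_verts u p) ! (j - 1)"
      using that len by (simp add: nth_tl w_def)
    then have "i - 1 = j - 1"
      using that p(2) len by (subst (asm) nth_eq_iff_index_eq) auto
    then show ?thesis using that by simp
  qed
  have closed: "w 0 = w k"
  proof -
    have "pawalk_verts u p \<noteq> []" using len by auto
    then have "w 0 = hd (pawalk_verts u p)" "w k = last (pawalk_verts u p)"
      using len by (simp_all add: w_def hd_conv_nth last_conv_nth)
    then show ?thesis using p(1) by (auto dest: awalk_ends)
  qed
  obtain i where i: "0 < i" "i \<le> k" and max: "\<And>j. 0 < j \<Longrightarrow> j \<le> k \<Longrightarrow> w j \<le> w i"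
  proof -
    have "finite (w ` {0<..k})" "w ` {0<..k} \<noteq> {}" using p(3) k_def by auto
    from Max_in[OF this] Max_ge[OF this(1)] that show ?thesis by fastforce
  qed
  have max0: "w j \<le> w i" if "j \<le> k" for j
    using max[of j] max[of k] closed that i by (cases "j = 0") auto
  \<comment> \<open>Cyclic successor and predecessor of \<open>i\<close> among the indices
    \<open>1\<close> to \<open>k\<close>; they differ because \<open>k\<close> is at least
    3.\<close>
  define j where "j = (if i = k then 1 else Suc i)"
  define l where "l = (if i = 1 then k else i - 1)"
  have "(w i, w j) \<in> parcs ?G"
    using adj[of i] adj[of 0] closed i by (auto simp: j_def)
  moreover have "(w l, w i) \<in> parcs ?G"
    using adj[of "i - 1"] closed i by (auto simp: l_def)
  moreover have jl: "0 < j" "j \<le> k" "0 < l" "l \<le> k" "j \<noteq> l"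
    using i p(3) k_def by (auto simp: j_def l_def)
  ultimately have "w j = f (w i)" "w l = f (w i)"
    using parent max0 by blast+
  then show False using inj[of j l] jl by simp
qed

section \<open>Distances in the broom\<close>

text \<open>A certificate for distances to \<open>v\<close>. By \<open>lip\<close>, \<open>d\<close>
  drops by at most one along an arc, so every walk from \<open>x\<close> to \<open>v\<close> has
  length at least \<open>d x\<close>. By \<open>step\<close>, away from \<open>v\<close> some arc
  lowers \<open>d\<close> by exactly one, and following such arcs gives a walk of length
  \<open>d u\<close>.\<close>

lemma graph_dist_eqI:
  assumes "pair_wf_digraph G"
    and "v \<in> pverts G" "u \<in> pverts G" "d v = 0"
    and lip: "\<And>x y. (x, y) \<in> parcs G \<Longrightarrow> d x \<le> Suc (d y)"
    and step: "\<And>x. x \<in> pverts G \<Longrightarrow> x \<noteq> v \<Longrightarrow> \<exists>y. (x, y) \<in> parcs G \<and> d x = Suc (d y)"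
  shows "graph_dist G u v = d u"
proof -
  interpret pair_wf_digraph G by fact
  have lower: "d x \<le> length p" if "awalk x p v" for x p
    using that
  proof (induction p arbitrary: x)
    case (Cons e p)
    then have "e \<in> parcs G" "fst e = x" "d (snd e) \<le> length p"
      by (auto simp: awalk_Cons_iff)
    then show ?case using lip[of x "snd e"] by (cases e) auto
  qed (use \<open>d v = 0\<close> in \<open>simp add: awalk_Nil_iff\<close>)
  have "\<exists>p. awalk x p v \<and> length p = m" if "x \<in> pverts G" "d x = m" for x m
    using that
  proof (induction m arbitrary: x)
    case 0
    then have "x = v" using step by force
    then show ?case using \<open>v \<in> pverts G\<close> by (simp add: awalk_Nil_iff)
  next
    case (Suc m)
    then obtain y where y: "(x, y) \<in> parcs G" "d y = m"
      using step[of x] \<open>d v = 0\<close> by force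
    then obtain p where "awalk y p v" "length p = m"
      using Suc.IH[of y] arc_snd_in_verts by force
    then show ?case using y by (intro exI[of _ "(x, y) # p"]) (simp add: awalk_Cons_iff)
  qed
  with \<open>u \<in> pverts G\<close> show ?thesis
    unfolding graph_dist_def by (intro Least_equality) (auto dest: lower)
qed

definition broom_parent :: "nat \<Rightarrow> nat" where
  "broom_parent v = (if v \<le> 9 then v - 1 else 4)"

definition broom :: "nat \<Rightarrow> nat pair_pre_digraph" where
  "broom N = parent_graph broom_parent (N + 9)"

text \<open>Subtraction on \<open>nat\<close> truncates at zero, so \<open>(u - v) + (v - u)\<close>
  is the absolute difference. A leaf is one edge further away than its neighbour
  \<open>4\<close>.\<close>

definition broom_dist :: "nat \<Rightarrow> nat \<Rightarrow> nat" where
  "broom_dist u v =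
     (if u = v then 0
      else if u \<le> 9 \<and> v \<le> 9 then (u - v) + (v - u)
      else if u \<le> 9 then Suc ((u - 4) + (4 - u))
      else if v \<le> 9 then Suc ((v - 4) + (4 - v))
      else 2)"

lemma tree_graph_broom: "tree_graph (broom N)"
  unfolding broom_def by (rule tree_graph_parent_graph) (auto simp: broom_parent_def)

lemma graph_dist_broom:
  assumes "u \<le> N + 9" "v \<le> N + 9"
  shows "graph_dist (broom N) u v = broom_dist u v"
proof (rule graph_dist_eqI[where d = "\<lambda>x. broom_dist x v"])
  have "pair_graph (broom N)"
    using tree_graph_broom by (auto simp: tree_graph_def connected_graph_def)
  then interpret pair_graph "broom N" .
  show "pair_wf_digraph (broom N)" ..
  show "\<exists>y. (x, y) \<in> parcs (broom N) \<and> broom_dist x v = Suc (broom_dist y v)"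
    if "x \<in> pverts (broom N)" "x \<noteq> v" for x
  proof -
    \<comment> \<open>\<open>t\<close> is the path vertex at or next to \<open>v\<close>, and
      \<open>y\<close> is the next vertex on the way from \<open>x\<close> to \<open>v\<close>: a
      leaf goes to \<open>4\<close>, a path vertex moves towards \<open>t\<close>, and from
      \<open>t\<close> itself the walk steps to the leaf \<open>v\<close>.\<close>
    define t where "t = (if v \<le> 9 then v else 4)"
    define y where "y = (if 9 < x then 4 else if t < x then x - 1 else if x < t then Suc x else v)"
    show ?thesis
      using assms that
      by (intro exI[of _ y])
         (auto simp: y_def t_def broom_def broom_parent_def broom_dist_def split: if_splits)
  qed
qed (use assms in \<open>auto simp: broom_def broom_parent_def broom_dist_def split: if_splits\<close>)

section \<open>Root location and the Wiener polynomial of the broom\<close>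

text \<open>In the product of the distances from \<open>z\<close> to the roots, each factor is at
  least the distance to a nearest root.\<close>

lemma exists_root_near:
  fixes p :: "complex poly"
  assumes "lead_coeff p = 1" "degree p > 0"
  shows "\<exists>r. poly p r = 0 \<and> cmod (z - r) ^ degree p \<le> cmod (poly p z)"
proof -
  obtain root where "smult (lead_coeff p) (\<Prod>i<degree p. [:-root i, 1:]) = p"
    by (rule complex_poly_decompose')
  then have p: "p = (\<Prod>i<degree p. [:-root i, 1:])"
    using assms by simp
  have eval: "poly p x = (\<Prod>i<degree p. x - root i)" for x
    by (subst p) (simp add: poly_prod)
  define i where "i = arg_min_on (\<lambda>i. cmod (z - root i)) {..<degree p}"
  have "i \<in> {..<degree p}"
    unfolding i_def using assms(2) by (intro arg_min_if_finite(1)) auto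
  have min: "cmod (z - root i) \<le> cmod (z - root j)" if "j < degree p" for j
    unfolding i_def using that by (intro arg_min_least) auto
  have "cmod (z - root i) ^ degree p = (\<Prod>j<degree p. cmod (z - root i))"
    by simp
  also have "\<dots> \<le> (\<Prod>j<degree p. cmod (z - root j))"
    using min by (intro prod_mono) auto
  also have "\<dots> = cmod (poly p z)"
    by (simp add: eval prod_norm)
  finally have "cmod (z - root i) ^ degree p \<le> cmod (poly p z)" .
  moreover have "poly p (root i) = 0"
    using \<open>i \<in> {..<degree p}\<close> by (auto simp: eval)
  ultimately show ?thesis by blast
qed

text \<open>On a path with ten vertices, \<open>10 - d\<close> pairs are at distance
  \<open>d\<close>.\<close>

lemma path_sum:
  "(\<Sum>(u, v) \<in> {(u, v). u \<le> 9 \<and> v \<le> 9 \<and> u < v}. monom (1::complex) (v - u)) =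
    [:0, 9, 8, 7, 6, 5, 4, 3, 2, 1:]"
proof -
  have "{(u, v). u \<le> 9 \<and> v \<le> 9 \<and> u < v} = (SIGMA u:{..9::nat}. {u<..9})"
    by auto
  then have "(\<Sum>(u, v) \<in> {(u, v). u \<le> 9 \<and> v \<le> 9 \<and> u < v}. monom (1::complex) (v - u)) =
      (\<Sum>u\<le>9. \<Sum>v\<in>{u<..9}. monom 1 (v - u))"
    by (simp add: sum.Sigma)
  also have "\<dots> = (\<Sum>u\<le>9. \<Sum>d=1..9-u. monom 1 d)"
  proof (rule sum.cong)
    fix u :: nat assume "u \<in> {..9}"
    then show "(\<Sum>v\<in>{u<..9}. monom (1::complex) (v - u)) = (\<Sum>d=1..9-u. monom 1 d)"
      by (intro sum.reindex_bij_witness[of _ "\<lambda>d. d + u" "\<lambda>v. v - u"]) auto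
  qed simp
  also have "\<dots> = [:0, 9, 8, 7, 6, 5, 4, 3, 2, 1:]"
    by (simp add: numeral_eq_Suc monom_Suc monom_0 del: One_nat_def)
  finally show ?thesis .
qed

text \<open>If \<open>Re a > 0\<close>, the root \<open>-1\<close> works. Otherwise take real part
  \<open>1/2\<close> and give the imaginary part the sign opposite to that of \<open>Im a\<close>:
  both contributions to the inner product are then nonpositive, and not both vanish.\<close>

lemma escape_cube_root:
  assumes "a \<noteq> 0"
  shows "\<exists>\<zeta>::complex. \<zeta> ^ 3 = -1 \<and> inner a \<zeta> < 0"
proof -
  define s where "s = (if Im a > 0 then - 1 else 1 :: real)"
  have s: "s^2 = 1" "s * Im a = - \<bar>Im a\<bar>" by (auto simp: s_def)
  show ?thesis
  proof (cases "Re a > 0")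
    case True
    then show ?thesis by (intro exI[of _ "-1"]) (simp add: inner_complex_def)
  next
    case False
    define z where "z = Complex (1/2) (s * sqrt 3 / 2)"
    \<comment> \<open>The polynomial \<open>z^2 - z + 1\<close> divides
      \<open>z^3 + 1\<close>.\<close>
    have "z ^ 2 = z - 1"
    proof -
      have "(s * sqrt 3) ^ 2 = 3" using s(1) by (simp add: power_mult_distrib)
      then show ?thesis by (simp add: z_def complex_eq_iff power2_eq_square)
    qed
    then have "z ^ 3 = -1"
      by algebra
    moreover have "inner a z = Re a / 2 + (s * Im a) * sqrt 3 / 2"
      by (simp add: z_def inner_complex_def)
    then have "inner a z = Re a / 2 - \<bar>Im a\<bar> * sqrt 3 / 2"
      by (simp add: s(2))
    moreover have "Re a / 2 - \<bar>Im a\<bar> * sqrt 3 / 2 < 0"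
    proof (cases "Im a = 0")
      case True
      then show ?thesis using False assms by (simp add: complex_eq_iff)
    next
      case nz: False
      then have "\<bar>Im a\<bar> * sqrt 3 > 0" by simp
      then show ?thesis using False by simp
    qed
    ultimately show ?thesis by (intro exI[of _ z]) simp
  qed
qed
text \<open>From a leaf, vertex \<open>4\<close> is at distance 1, two path vertices are at each
  distance from 2 to 5, and only \<open>9\<close> is at distance 6. This last pair, one per leaf,
  yields the term \<open>N x^6\<close>.\<close>

lemma path_leaf_sum:
  "(\<Sum>(u, v) \<in> {..9} \<times> {9<..N + 9}. monom (1::complex) (Suc ((u - 4) + (4 - u)))) =
    smult (of_nat N) [:0, 1, 2, 2, 2, 2, 1:]"
proof -
  have "(\<Sum>(u, v) \<in> {..9} \<times> {9<..N + 9}. monom (1::complex) (Suc ((u - 4) + (4 - u)))) =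
      of_nat N * (\<Sum>u\<le>9. monom 1 (Suc ((u - 4) + (4 - u))))"
    by (simp add: sum.cartesian_product[symmetric] sum_distrib_left)
  also have "(\<Sum>u\<le>9. monom (1::complex) (Suc ((u - 4) + (4 - u)))) = [:0, 1, 2, 2, 2, 2, 1:]"
    by (simp add: numeral_eq_Suc monom_Suc monom_0 del: One_nat_def)
  finally show ?thesis by (simp add: of_nat_poly)
qed

text \<open>The three summands come from pairs inside the path, pairs of a path vertex and a leaf,
  and pairs of leaves, the last all at distance 2. The bound \<open>N^2\<close> on their number
  makes that term of order \<open>R^8\<close> when \<open>N = R^3\<close> and \<open>x\<close> has
  modulus \<open>R\<close>.\<close>

lemma wiener_poly_broom:
  "\<exists>c \<le> N\<^sup>2. wiener_poly (broom N) =
     [:0, 9, 8, 7, 6, 5, 4, 3, 2, 1:] + smult (of_nat N) [:0, 1, 2, 2, 2, 2, 1:] +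
     smult (of_nat c) [:0, 0, 1:]"
proof -
  define A :: "(nat \<times> nat) set" where "A = {(u, v). u \<le> 9 \<and> v \<le> 9 \<and> u < v}"
  define B :: "(nat \<times> nat) set" where "B = {..9} \<times> {9<..N + 9}"
  define C where "C = {(u, v). 9 < u \<and> u < v \<and> v \<le> N + 9}"
  have "A \<subseteq> {..9} \<times> {..9}" by (auto simp: A_def)
  then have "finite A" by (rule finite_subset) simp
  have C: "C \<subseteq> {9<..N + 9} \<times> {9<..N + 9}" by (auto simp: C_def)
  then have "finite C" by (rule finite_subset) simp
  have "card C \<le> N\<^sup>2"
    using card_mono[OF _ C] by (simp add: power2_eq_square)
  have "wiener_poly (broom N) = (\<Sum>(u, v) \<in> A \<union> B \<union> C. monom 1 (broom_dist u v))"
    unfolding wiener_poly_def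
    by (rule sum.cong) (auto simp: A_def B_def C_def broom_def graph_dist_broom[unfolded broom_def])
  also have "\<dots> = (\<Sum>(u, v) \<in> A. monom 1 (broom_dist u v)) +
      (\<Sum>(u, v) \<in> B. monom 1 (broom_dist u v)) + (\<Sum>(u, v) \<in> C. monom 1 (broom_dist u v))"
    using \<open>finite A\<close> \<open>finite C\<close>
    by (subst sum.union_disjoint; (subst sum.union_disjoint)?) (auto simp: A_def B_def C_def)
  also have "(\<Sum>(u, v) \<in> A. monom (1::complex) (broom_dist u v)) = [:0, 9, 8, 7, 6, 5, 4, 3, 2, 1:]"
    unfolding path_sum[symmetric] A_def by (rule sum.cong) (auto simp: broom_dist_def)
  also have "(\<Sum>(u, v) \<in> B. monom (1::complex) (broom_dist u v)) =
      smult (of_nat N) [:0, 1, 2, 2, 2, 2, 1:]"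
    unfolding path_leaf_sum[symmetric] B_def by (rule sum.cong) (auto simp: broom_dist_def)
  also have "(\<Sum>(u, v) \<in> C. monom (1::complex) (broom_dist u v)) = (\<Sum>_ \<in> C. monom 1 2)"
    by (rule sum.cong) (auto simp: C_def broom_dist_def)
  also have "\<dots> = smult (of_nat (card C)) [:0, 0, 1:]"
    by (simp add: of_nat_poly numeral_eq_Suc monom_Suc monom_0)
  finally show ?thesis using \<open>card C \<le> N\<^sup>2\<close> by blast
qed

section \<open>Roots leaving every half-plane\<close>

lemma broom_root_near:
  fixes \<zeta> :: complex
  assumes "\<zeta> ^ 3 = -1" "R \<ge> 1"
  shows "\<exists>r \<in> wiener_roots (broom (R ^ 3)). cmod (of_nat R * \<zeta> - r) ^ 9 \<le> 54 * real R ^ 8"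
proof -
  define z where "z = of_nat R * \<zeta>"
  have "cmod \<zeta> ^ 3 = 1"
    using assms(1) by (metis norm_minus_cancel norm_one norm_power)
  then have "cmod \<zeta> = 1"
    using power_eq_iff_eq_base[of 3 "cmod \<zeta>" 1] by simp
  then have norm_z: "cmod z = real R" by (simp add: z_def norm_mult)
  obtain c where c: "c \<le> (R ^ 3)\<^sup>2" and W: "wiener_poly (broom (R ^ 3)) =
     [:0, 9, 8, 7, 6, 5, 4, 3, 2, 1:] + smult (of_nat (R ^ 3)) [:0, 1, 2, 2, 2, 2, 1:] +
     smult (of_nat c) [:0, 0, 1:]" (is "?W = _")
    using wiener_poly_broom[of "R ^ 3"] by blast
  have deg: "degree ?W = 9" "lead_coeff ?W = 1"
    unfolding W by simp_all
  define n :: complex where "n = of_nat (R ^ 3)"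
  have "z ^ 3 = - n"
    using assms(1) by (simp add: z_def n_def power_mult_distrib)
  \<comment> \<open>Here \<open>z^9 = -n^3\<close> and \<open>n z^6 = n^3\<close>; this is why the
    number of leaves is \<open>R^3\<close>.\<close>
  then have "z ^ 9 + n * z ^ 6 = 0"
    by algebra
  moreover have "poly ?W z = z ^ 9 + n * z ^ 6 +
      ((9 + n) * z + (8 + 2 * n + of_nat c) * z ^ 2 + (7 + 2 * n) * z ^ 3 + (6 + 2 * n) * z ^ 4 +
       (5 + 2 * n) * z ^ 5 + 4 * z ^ 6 + 3 * z ^ 7 + 2 * z ^ 8)"
    unfolding W n_def[symmetric] by (simp add: algebra_simps eval_nat_numeral)
  ultimately have eval: "poly ?W z =
      (9 + n) * z + (8 + 2 * n + of_nat c) * z ^ 2 + (7 + 2 * n) * z ^ 3 + (6 + 2 * n) * z ^ 4 +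
       (5 + 2 * n) * z ^ 5 + 4 * z ^ 6 + 3 * z ^ 7 + 2 * z ^ 8"
    by simp
  \<comment> \<open>Each remaining term has a coefficient of order \<open>R^m\<close> and a power
    \<open>z^j\<close> with \<open>m + j\<close> at most 8. The constants \<open>b\<close> obtained
    below add up to 54.\<close>
  have term_le: "cmod (k * z ^ j) \<le> b * real R ^ 8"
    if "cmod k \<le> b * real R ^ m" "m + j \<le> 8" "0 \<le> b" for k b m j
  proof -
    have "cmod (k * z ^ j) \<le> b * real R ^ m * real R ^ j"
      using that(1) by (simp add: norm_mult norm_power norm_z mult_right_mono)
    also have "\<dots> = b * real R ^ (m + j)" by (simp add: power_add)
    also have "\<dots> \<le> b * real R ^ 8"
      using that assms(2) by (intro mult_left_mono power_increasing) auto
    finally show ?thesis .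
  qed
  have n_norm: "cmod n = real R ^ 3" by (simp add: n_def norm_power)
  have one: "1 \<le> real R ^ m" for m
    using assms(2) by simp
  have coeff: "cmod (of_nat a + of_nat b * n) \<le> (real a + real b) * real R ^ 3" for a b
  proof -
    have "cmod (of_nat a + of_nat b * n) \<le> real a + real b * real R ^ 3"
      by (rule norm_triangle_le) (simp add: norm_mult n_norm)
    also have "\<dots> \<le> real a * real R ^ 3 + real b * real R ^ 3"
      using mult_left_mono[OF one[of 3], of "real a"] by simp
    finally show ?thesis by (simp add: algebra_simps)
  qed
  \<comment> \<open>The constant 11 splits as 10 for \<open>8 + 2 * n\<close> and 1 for the leaf
    pairs, whose number is at most \<open>R^6\<close>.\<close>
  have "cmod (8 + 2 * n + of_nat c) \<le> 11 * real R ^ 6"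
  proof -
    have "cmod (8 + 2 * n + of_nat c) \<le> 10 * real R ^ 3 + real c"
      using coeff[of 8 2] by (intro norm_triangle_le) simp
    moreover have "real c \<le> real R ^ 6"
      using c by (simp add: power_mult[symmetric] flip: of_nat_power)
    moreover have "real R ^ 3 \<le> real R ^ 6"
      using assms(2) by (intro power_increasing) auto
    ultimately show ?thesis by linarith
  qed
  then have "cmod ((8 + 2 * n + of_nat c) * z ^ 2) \<le> 11 * real R ^ 8"
    by (intro term_le[where m = 6]) auto
  moreover have "cmod ((9 + n) * z) \<le> 10 * real R ^ 8"
    using coeff[of 9 1] term_le[of "9 + n" 10 3 1] by simp
  moreover have "cmod ((7 + 2 * n) * z ^ 3) \<le> 9 * real R ^ 8"
    using coeff[of 7 2] by (intro term_le[where m = 3]) auto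
  moreover have "cmod ((6 + 2 * n) * z ^ 4) \<le> 8 * real R ^ 8"
    using coeff[of 6 2] by (intro term_le[where m = 3]) auto
  moreover have "cmod ((5 + 2 * n) * z ^ 5) \<le> 7 * real R ^ 8"
    using coeff[of 5 2] by (intro term_le[where m = 3]) auto
  moreover have "cmod (4 * z ^ 6) \<le> 4 * real R ^ 8"
    by (intro term_le[where m = 0]) auto
  moreover have "cmod (3 * z ^ 7) \<le> 3 * real R ^ 8"
    by (intro term_le[where m = 0]) auto
  moreover have "cmod (2 * z ^ 8) \<le> 2 * real R ^ 8"
    by (intro term_le[where m = 0]) auto
  ultimately have "cmod (poly ?W z) \<le> 10 * real R ^ 8 + 11 * real R ^ 8 + 9 * real R ^ 8 +
      8 * real R ^ 8 + 7 * real R ^ 8 + 4 * real R ^ 8 + 3 * real R ^ 8 + 2 * real R ^ 8"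
    unfolding eval by (intro norm_triangle_mono)
  then have "cmod (poly ?W z) \<le> 54 * real R ^ 8" by simp
  then show ?thesis
    using exists_root_near[of ?W z] deg by (force simp: wiener_roots_def z_def)
qed

text \<open>In a direction \<open>\<zeta>\<close> with \<open>inner a \<zeta> < 0\<close>, the inner
  product of \<open>a\<close> with \<open>R \<zeta>\<close> decreases linearly in \<open>R\<close>,
  faster than the displacement of the nearby root can compensate.\<close>

lemma tree_wiener_roots_unbounded:
  assumes "a \<noteq> 0"
  shows "\<exists>r \<in> tree_wiener_roots. inner a r < b"
proof -
  obtain \<zeta> :: complex where \<zeta>: "\<zeta> ^ 3 = -1" "inner a \<zeta> < 0"
    using escape_cube_root[OF assms] by blast
  define m where "m = - inner a \<zeta>"
  \<comment> \<open>With this \<open>\<delta>\<close>, a displacement of at most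
    \<open>\<delta> R\<close> changes the inner product with \<open>a\<close> by at most
    \<open>R m / 2\<close>, half of the available decrease \<open>R m\<close>.\<close>
  define \<delta> where "\<delta> = m / (2 * cmod a)"
  have "m > 0" using \<zeta>(2) by (simp add: m_def)
  then have "\<delta> > 0" using assms by (simp add: \<delta>_def)
  \<comment> \<open>The second bound makes \<open>54 R^8\<close> at most
    \<open>(\<delta> R)^9\<close>, which puts the root within \<open>\<delta> R\<close>; the third
    makes \<open>- R m / 2\<close> smaller than \<open>b\<close>.\<close>
  obtain R :: nat where R: "real R > max 1 (max (54 / \<delta> ^ 9) (- 2 * b / m))"
    using reals_Archimedean2 by blast
  then have "R \<ge> 1" by simp
  obtain r where r: "r \<in> wiener_roots (broom (R ^ 3))"
    and near: "cmod (of_nat R * \<zeta> - r) ^ 9 \<le> 54 * real R ^ 8"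
    using broom_root_near[OF \<zeta>(1) \<open>R \<ge> 1\<close>] by blast
  have "54 \<le> \<delta> ^ 9 * real R"
    using R \<open>\<delta> > 0\<close> by (simp add: divide_less_eq mult.commute)
  then have "54 * real R ^ 8 \<le> \<delta> ^ 9 * real R * real R ^ 8"
    by (rule mult_right_mono) simp
  also have "\<dots> = (\<delta> * real R) ^ 9"
    by (simp add: power_mult_distrib eval_nat_numeral)
  finally have "cmod (of_nat R * \<zeta> - r) ^ 9 \<le> (\<delta> * real R) ^ 9"
    using near by linarith
  then have close: "cmod (of_nat R * \<zeta> - r) \<le> \<delta> * real R"
    using \<open>\<delta> > 0\<close> by (simp add: power_mono_iff)
  have "inner a r = inner a (of_nat R * \<zeta>) + inner a (r - of_nat R * \<zeta>)"
    by (simp add: inner_diff_right)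
  also have "inner a (of_nat R * \<zeta>) = - (real R * m)"
    by (simp add: m_def inner_complex_def algebra_simps)
  also have "inner a (r - of_nat R * \<zeta>) \<le> cmod a * (\<delta> * real R)"
    using norm_cauchy_schwarz[of a "r - of_nat R * \<zeta>"] close
    by (metis mult_left_mono norm_ge_zero norm_minus_commute order_trans)
  also have "cmod a * (\<delta> * real R) = real R * m / 2"
    using assms by (simp add: \<delta>_def)
  finally have "inner a r \<le> - (real R * m / 2)" by (simp add: mult.commute)
  moreover have "- (real R * m / 2) < b"
    using R \<open>m > 0\<close> by (simp add: field_simps)
  moreover have "r \<in> tree_wiener_roots"
    unfolding tree_wiener_roots_def
    using r tree_graph_broom by (auto intro!: exI[of _ "broom (R ^ 3)"] simp: broom_def)
  ultimately show ?thesis by force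
qed

theorem theorem14:
  shows "\<not> (\<exists>H. half_plane H \<and> tree_wiener_roots \<subseteq> H) \<and>
         \<not> (\<exists>H. half_plane H \<and> connected_wiener_roots \<subseteq> H)"
proof -
  have "\<not> tree_wiener_roots \<subseteq> H" if "half_plane H" for H
  proof
    assume "tree_wiener_roots \<subseteq> H"
    moreover obtain a b where "a \<noteq> 0" "H \<subseteq> {z. inner a z \<ge> b}"
      using \<open>half_plane H\<close> by (auto simp: half_plane_def)
    ultimately show False
      using tree_wiener_roots_unbounded[of a b] by force
  qed
  moreover have "tree_wiener_roots \<subseteq> connected_wiener_roots"
    by (auto simp: tree_wiener_roots_def connected_wiener_roots_def tree_graph_def)
  ultimately show ?thesis by blast
qed

end
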